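(* For the Adwords problem in the i.i.d. model with unknown distribution, and for every value of $\gamma\in[0,1]$, the expected revenue of the greedy algorithm is at least $(1-1/e)$ times the optimal value of the expected-instance LP $\max\{\sum_{i,j} b_{ij}x_{ij}y_j : \sum_j b_{ij}x_{ij}y_j\leq B_i\ \forall i,\ \sum_i x_{ij}\leq 1\ \forall j,\ x\geq 0\}$.
   Context: Adwords problem: there are $n$ advertisers, advertiser $i$ having budget $B_i>0$, and a set of query types; advertiser $i$ bids $b_{ij}\geq 0$ for query type $j$, with $b_{ij}\leq B_i$. $m$ queries arrive one by one, each drawn independently, query type $j$ with probability $p_j$; let $y_j=mp_j$. Each arriving query is irrevocably allocated to at most one advertiser. Budgets are soft: if a query $j$ is allocated to $i$ when $i$'s remaining budget is $R$, the revenue earned is $\min(b_{ij},R)$, and $i$'s remaining budget decreases by that amount (so advertiser $i$ pays in total the minimum of its budget and the sum of its allocated bids). $\gamma=\max_{i,j} b_{ij}/B_i$. The greedy algorithm (which does not know the distribution) allocates each arriving query $j$ to an advertiser maximizing the effective bid $\min(b_{ij}, \text{remaining budget of } i)$. *)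

theory Defs
  imports "HOL-Probability.Probability"
begin

text \<open>Advertisers are the elements of the finite type \<open>'a\<close>, query types those of the finite type \<open>'q\<close>;
  \<open>B i\<close> is the budget of advertiser \<open>i\<close> and \<open>b i j\<close> its bid for query type \<open>j\<close>.\<close>

definition adwords_instance :: "('a::finite \<Rightarrow> real) \<Rightarrow> ('a \<Rightarrow> 'q::finite \<Rightarrow> real) \<Rightarrow> bool" where
  "adwords_instance B b \<longleftrightarrow> (\<forall>i. 0 < B i) \<and> (\<forall>i j. 0 \<le> b i j \<and> b i j \<le> B i)"

definition max_bid_ratio :: "('a::finite \<Rightarrow> real) \<Rightarrow> ('a \<Rightarrow> 'q::finite \<Rightarrow> real) \<Rightarrow> real" where
  "max_bid_ratio B b = Max (range (\<lambda>(i, j). b i j / B i))"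

text \<open>An online algorithm maps the queries that arrived so far (in order of arrival) and the current
  query to the advertiser receiving the current query, or to \<^const>\<open>None\<close> if it stays unallocated.\<close>

type_synonym ('a, 'q) online_alg = "'q list \<Rightarrow> 'q \<Rightarrow> 'a option"

text \<open>\<open>remaining B b alg qs t i\<close> is the budget left to advertiser \<open>i\<close> after the first \<open>t\<close> queries
  of the sequence \<open>qs\<close>; it is meaningful for \<open>t \<le> length qs\<close>.\<close>

primrec remaining ::
  "('a \<Rightarrow> real) \<Rightarrow> ('a \<Rightarrow> 'q \<Rightarrow> real) \<Rightarrow> ('a, 'q) online_alg \<Rightarrow> 'q list \<Rightarrow> nat \<Rightarrow> 'a \<Rightarrow> real" where
  "remaining B b alg qs 0 i = B i"
| "remaining B b alg qs (Suc t) i =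
     remaining B b alg qs t i -
       (if alg (take t qs) (qs ! t) = Some i
        then min (b i (qs ! t)) (remaining B b alg qs t i) else 0)"

definition revenue ::
  "('a \<Rightarrow> real) \<Rightarrow> ('a \<Rightarrow> 'q \<Rightarrow> real) \<Rightarrow> ('a, 'q) online_alg \<Rightarrow> 'q list \<Rightarrow> real" where
  "revenue B b alg qs =
     (\<Sum>t<length qs. case alg (take t qs) (qs ! t) of
        None \<Rightarrow> 0
      | Some i \<Rightarrow> min (b i (qs ! t)) (remaining B b alg qs t i))"

text \<open>Ties may be broken arbitrarily, and differently at different times.\<close>

definition greedy ::
  "('a \<Rightarrow> real) \<Rightarrow> ('a \<Rightarrow> 'q \<Rightarrow> real) \<Rightarrow> ('a, 'q) online_alg \<Rightarrow> bool" where
  "greedy B b alg \<longleftrightarrow>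
     (\<forall>past j. \<exists>i. alg past j = Some i \<and>
        is_arg_max (\<lambda>k. min (b k j) (remaining B b alg past (length past) k)) (\<lambda>_. True) i)"

definition lp_feasible ::
  "('a::finite \<Rightarrow> real) \<Rightarrow> ('a \<Rightarrow> 'q::finite \<Rightarrow> real) \<Rightarrow> ('q \<Rightarrow> real) \<Rightarrow> ('a \<Rightarrow> 'q \<Rightarrow> real) set" where
  "lp_feasible B b y =
     {x. (\<forall>i. (\<Sum>j\<in>UNIV. b i j * x i j * y j) \<le> B i) \<and>
         (\<forall>j. (\<Sum>i\<in>UNIV. x i j) \<le> 1) \<and>
         (\<forall>i j. 0 \<le> x i j)}"

definition lp_opt ::
  "('a::finite \<Rightarrow> real) \<Rightarrow> ('a \<Rightarrow> 'q::finite \<Rightarrow> real) \<Rightarrow> ('q \<Rightarrow> real) \<Rightarrow> real" where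
  "lp_opt B b y =
     (SUP x\<in>lp_feasible B b y. \<Sum>i\<in>UNIV. \<Sum>j\<in>UNIV. b i j * x i j * y j)"

text \<open>The supremum of reals in \<open>lp_opt\<close> is taken over a nonempty set that is bounded above.\<close>

lemma lp_feasible_nonempty:
  assumes "adwords_instance B b"
  shows "lp_feasible B b y \<noteq> {}"
proof -
  have "(\<lambda>_ _. 0) \<in> lp_feasible B b y"
    using assms by (auto simp: lp_feasible_def adwords_instance_def less_imp_le)
  then show ?thesis by blast
qed

lemma lp_objective_bdd_above:
  "bdd_above ((\<lambda>x. \<Sum>i\<in>UNIV. \<Sum>j\<in>UNIV. b i j * x i j * y j) ` lp_feasible B b y)"
  by (rule bdd_aboveI2[where M = "\<Sum>i\<in>UNIV. B i"]) (auto simp: lp_feasible_def intro: sum_mono)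

end

theory Submission
  imports Defs
begin

text \<open>Fix a feasible \<open>x\<close> of value \<open>C = \<Sum>\<^sub>i C\<^sub>i\<close>, where \<open>C\<^sub>i\<close> is what \<open>x\<close> extracts from advertiser \<open>i\<close>.
  When the remaining budgets are \<open>R\<^sub>i\<close>, greedy gains at least as much on the next query as the random
  assignment given by \<open>x\<close>. As \<open>min b\<^sub>i\<^sub>j R\<^sub>i \<ge> b\<^sub>i\<^sub>j R\<^sub>i / B\<^sub>i\<close>, its expected gain is at least
  \<open>(1/m) \<Sum>\<^sub>i C\<^sub>i R\<^sub>i / B\<^sub>i \<ge> (1/m) \<Sum>\<^sub>i (C\<^sub>i - (B\<^sub>i - R\<^sub>i))\<close>, which is \<open>1/m\<close> times the gap between \<open>C\<close> and the
  revenue so far. Hence the expected gap shrinks by the factor \<open>1 - 1/m\<close> with every query, and by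
  \<open>(1 - 1/m)\<^sup>m \<le> 1/e\<close> in total.\<close>

lemma remaining_append:
  "t \<le> length qs \<Longrightarrow> remaining B b alg (qs @ rs) t i = remaining B b alg qs t i"
  by (induction t) (auto simp: nth_append)

lemma remaining_snoc:
  "remaining B b alg (qs @ [j]) (length (qs @ [j])) i =
     remaining B b alg qs (length qs) i -
       (if alg qs j = Some i then min (b i j) (remaining B b alg qs (length qs) i) else 0)"
  by (simp add: remaining_append)

lemma revenue_snoc:
  "revenue B b alg (qs @ [j]) = revenue B b alg qs +
     (case alg qs j of None \<Rightarrow> 0 | Some i \<Rightarrow> min (b i j) (remaining B b alg qs (length qs) i))"
proof -
  have "(\<Sum>t<length qs. case alg (take t (qs @ [j])) ((qs @ [j]) ! t) of None \<Rightarrow> 0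
      | Some i \<Rightarrow> min (b i ((qs @ [j]) ! t)) (remaining B b alg (qs @ [j]) t i)) = revenue B b alg qs"
    unfolding revenue_def
    by (intro sum.cong refl) (simp add: nth_append remaining_append split: option.split)
  then show ?thesis
    by (simp add: revenue_def remaining_append split: option.split)
qed

lemma remaining_bounds:
  assumes "adwords_instance B b"
  shows "0 \<le> remaining B b alg qs t i" "remaining B b alg qs t i \<le> B i"
proof -
  have "0 \<le> remaining B b alg qs t i \<and> remaining B b alg qs t i \<le> B i"
  proof (induction t)
    case 0
    then show ?case using assms by (auto simp: adwords_instance_def less_imp_le)
  next
    case (Suc t)
    have "0 \<le> b i (qs ! t)" using assms by (auto simp: adwords_instance_def)
    with Suc show ?case by auto
  qed
  then show "0 \<le> remaining B b alg qs t i" "remaining B b alg qs t i \<le> B i" by auto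
qed

text \<open>Each query earns exactly the amount deducted from the chosen advertiser's budget. This
  splits the gap between \<open>C\<close> and the revenue so far into one term per
  advertiser.\<close>

lemma revenue_eq_spent_budget:
  fixes B :: "'a::finite \<Rightarrow> real"
  shows "revenue B b alg qs = (\<Sum>i\<in>UNIV. B i - remaining B b alg qs (length qs) i)"
proof (induction qs rule: rev_induct)
  case Nil
  then show ?case by (simp add: revenue_def)
next
  case (snoc j qs)
  show ?case
    unfolding remaining_snoc revenue_snoc snoc
    by (cases "alg qs j") (simp_all add: algebra_simps sum.distrib sum_subtractf)
qed

text \<open>\<open>z\<close> stands for a column of an LP solution, read as a fractional assignment
  of \<open>j\<close>. The largest effective bid is at least any weighted sum of effective bids with
  total weight at most 1.\<close>

lemma greedy_gain:
  fixes B :: "'a::finite \<Rightarrow> real"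
  assumes "adwords_instance B b" "greedy B b alg" "\<And>i. 0 \<le> z i" "(\<Sum>i\<in>UNIV. z i) \<le> 1"
  shows "revenue B b alg qs + (\<Sum>i\<in>UNIV. z i * (b i j * remaining B b alg qs (length qs) i / B i))
    \<le> revenue B b alg (qs @ [j])"
proof -
  let ?R = "remaining B b alg qs (length qs)"
  obtain k where k: "alg qs j = Some k"
    and max: "is_arg_max (\<lambda>i. min (b i j) (?R i)) (\<lambda>_. True) k"
    using assms(2) unfolding greedy_def by blast
  have le: "min (b i j) (?R i) \<le> min (b k j) (?R k)" for i
    using max by (simp add: is_arg_max_linorder)
  \<comment> \<open>With both \<open>b i j\<close> and the remaining budget at most
    \<open>B i\<close>, dividing their product by \<open>B i\<close> leaves at most either
    factor.\<close>
  have scaled: "b i j * ?R i / B i \<le> min (b i j) (?R i)" for i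
  proof -
    have "0 < B i" "0 \<le> b i j" "b i j \<le> B i"
      using assms(1) by (auto simp: adwords_instance_def)
    moreover have "0 \<le> ?R i" "?R i \<le> B i" using remaining_bounds[OF assms(1)] by auto
    ultimately show ?thesis
      by (simp add: pos_divide_le_eq mult_left_mono) (metis mult.commute mult_right_mono)
  qed
  \<comment> \<open>The weights may sum to less than 1, so bounding by the full maximum requires its
    sign.\<close>
  have nonneg: "0 \<le> min (b k j) (?R k)"
    using assms(1) remaining_bounds(1)[OF assms(1)] by (auto simp: adwords_instance_def)
  have "(\<Sum>i\<in>UNIV. z i * (b i j * ?R i / B i)) \<le> (\<Sum>i\<in>UNIV. z i * min (b k j) (?R k))"
    by (intro sum_mono mult_left_mono assms(3) order.trans[OF scaled le])
  also have "\<dots> \<le> min (b k j) (?R k)"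
    unfolding sum_distrib_right[symmetric] using mult_right_mono[OF assms(4) nonneg] by simp
  finally show ?thesis by (simp add: revenue_snoc k)
qed

text \<open>Average \<open>greedy_gain\<close> over \<open>j\<close>, with the column of
  \<open>x\<close> at \<open>j\<close> as \<open>z\<close>; the budget constraints of the LP bring
  in the gap.\<close>

lemma expected_greedy_gain:
  fixes B :: "'a::finite \<Rightarrow> real" and b :: "'a \<Rightarrow> 'q::finite \<Rightarrow> real"
  assumes inst: "adwords_instance B b" and "greedy B b alg" and "m > 0"
    and x: "x \<in> lp_feasible B b (\<lambda>j. real m * pmf p j)"
    and C: "C = (\<Sum>i\<in>UNIV. \<Sum>j\<in>UNIV. b i j * x i j * (real m * pmf p j))"
  shows "revenue B b alg qs + (C - revenue B b alg qs) / m
    \<le> (\<Sum>j\<in>UNIV. pmf p j * revenue B b alg (qs @ [j]))"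
proof -
  let ?R = "remaining B b alg qs (length qs)"
  define c where "c i = (\<Sum>j\<in>UNIV. b i j * x i j * (real m * pmf p j))" for i
  have "C - revenue B b alg qs = (\<Sum>i\<in>UNIV. c i - (B i - ?R i))"
    by (simp add: C c_def revenue_eq_spent_budget sum_subtractf)
  also have "\<dots> \<le> (\<Sum>i\<in>UNIV. c i * (?R i / B i))"
  proof (rule sum_mono)
    fix i
    have B: "0 < B i" using inst by (auto simp: adwords_instance_def)
    have "c i \<le> B i" using x by (simp add: lp_feasible_def c_def)
    \<comment> \<open>Both factors are nonnegative, the second by the budget constraint; expanding
      their product gives the claim.\<close>
    then have "0 \<le> (B i - ?R i) * (1 - c i / B i)"
      using B remaining_bounds(2)[OF inst] by (intro mult_nonneg_nonneg) auto
    also have "\<dots> = c i * (?R i / B i) - (c i - (B i - ?R i))"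
      using B by (simp add: field_simps)
    finally show "c i - (B i - ?R i) \<le> c i * (?R i / B i)" by simp
  qed
  also have "\<dots> = (\<Sum>i\<in>UNIV. \<Sum>j\<in>UNIV. m * (pmf p j * (x i j * (b i j * ?R i / B i))))"
    unfolding c_def sum_distrib_right by (intro sum.cong refl) simp
  also have "\<dots> = m * (\<Sum>j\<in>UNIV. pmf p j * (\<Sum>i\<in>UNIV. x i j * (b i j * ?R i / B i)))"
    by (subst sum.swap) (simp add: sum_distrib_left)
  finally have "(C - revenue B b alg qs) / m
      \<le> (\<Sum>j\<in>UNIV. pmf p j * (\<Sum>i\<in>UNIV. x i j * (b i j * ?R i / B i)))"
    using \<open>m > 0\<close> by (simp add: pos_divide_le_eq mult.commute)
  moreover have "(\<Sum>j\<in>UNIV. pmf p j * revenue B b alg qs) = revenue B b alg qs"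
    by (simp add: sum_distrib_right[symmetric] sum_pmf_eq_1)
  ultimately have "revenue B b alg qs + (C - revenue B b alg qs) / m
      \<le> (\<Sum>j\<in>UNIV. pmf p j * (revenue B b alg qs + (\<Sum>i\<in>UNIV. x i j * (b i j * ?R i / B i))))"
    by (simp add: distrib_left sum.distrib)
  also have "\<dots> \<le> (\<Sum>j\<in>UNIV. pmf p j * revenue B b alg (qs @ [j]))"
    using x by (intro sum_mono mult_left_mono greedy_gain assms) (auto simp: lp_feasible_def)
  finally show ?thesis .
qed

lemma expectation_replicate_pmf_Suc:
  fixes p :: "'q::finite pmf" and f :: "'q list \<Rightarrow> real"
  shows "measure_pmf.expectation (replicate_pmf (Suc n) p) f =
    (\<Sum>j\<in>UNIV. pmf p j * measure_pmf.expectation (replicate_pmf n p) (\<lambda>qs. f (j # qs)))"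
proof -
  have "finite (set_pmf (replicate_pmf n p))"
    by (rule finite_subset[OF _ finite_lists_length_eq[of UNIV n]]) (auto simp: set_replicate_pmf)
  then have "measure_pmf.expectation (p \<bind> (\<lambda>j. map_pmf ((#) j) (replicate_pmf n p))) f =
    (\<Sum>j\<in>UNIV. pmf p j *\<^sub>R measure_pmf.expectation (map_pmf ((#) j) (replicate_pmf n p)) f)"
    by (intro pmf_expectation_bind) auto
  then show ?thesis by (simp add: map_pmf_def[symmetric])
qed

text \<open>Conditioning on the past \<open>qs\<close> lets the induction peel off the next query, which is the head
  of the remaining sequence.\<close>

lemma expected_greedy_revenue:
  fixes B :: "'a::finite \<Rightarrow> real" and b :: "'a \<Rightarrow> 'q::finite \<Rightarrow> real"
  assumes "adwords_instance B b" and "greedy B b alg" and "m > 0"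
    and "x \<in> lp_feasible B b (\<lambda>j. real m * pmf p j)"
    and C: "C = (\<Sum>i\<in>UNIV. \<Sum>j\<in>UNIV. b i j * x i j * (real m * pmf p j))"
  shows "C - (1 - 1 / m) ^ n * (C - revenue B b alg qs)
    \<le> measure_pmf.expectation (replicate_pmf n p) (\<lambda>rs. revenue B b alg (qs @ rs))"
proof (induction n arbitrary: qs)
  case 0
  then show ?case by simp
next
  case (Suc n)
  define r where "r = 1 - 1 / real m"
  have "r \<ge> 0" using \<open>m > 0\<close> by (simp add: r_def)
  \<comment> \<open>One factor \<open>r\<close> is spent on turning the current gap into the gap
    after the guaranteed expected gain.\<close>
  have "C - r ^ Suc n * (C - revenue B b alg qs)
      = C - r ^ n * C + r ^ n * (revenue B b alg qs + (C - revenue B b alg qs) / m)"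
    by (simp add: r_def algebra_simps diff_divide_distrib)
  also have "\<dots> \<le> C - r ^ n * C + r ^ n * (\<Sum>j\<in>UNIV. pmf p j * revenue B b alg (qs @ [j]))"
    using \<open>r \<ge> 0\<close> expected_greedy_gain[OF assms] by (intro add_left_mono mult_left_mono) auto
  \<comment> \<open>The constant is written as an average over \<open>j\<close>, so that each
    summand becomes the induction hypothesis for the history \<open>qs @ [j]\<close>.\<close>
  also have "\<dots> = (\<Sum>j\<in>UNIV. pmf p j * (C - r ^ n * C))
      + r ^ n * (\<Sum>j\<in>UNIV. pmf p j * revenue B b alg (qs @ [j]))"
    by (simp add: sum_distrib_right[symmetric] sum_pmf_eq_1)
  also have "\<dots> = (\<Sum>j\<in>UNIV. pmf p j * (C - r ^ n * (C - revenue B b alg (qs @ [j]))))"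
    by (simp add: sum_distrib_left sum.distrib[symmetric] algebra_simps)
  also have "\<dots> \<le> (\<Sum>j\<in>UNIV. pmf p j *
      measure_pmf.expectation (replicate_pmf n p) (\<lambda>rs. revenue B b alg ((qs @ [j]) @ rs)))"
    unfolding r_def by (intro sum_mono mult_left_mono Suc.IH) auto
  finally show ?case unfolding expectation_replicate_pmf_Suc r_def by simp
qed

lemma one_minus_inverse_power_le:
  assumes "m > 0"
  shows "(1 - 1 / real m) ^ m \<le> 1 / exp 1"
  using exp_ge_one_minus_x_over_n_power_n[of 1 m] assms by (simp add: exp_minus field_simps)

theorem theorem3:
  fixes B :: "'a::finite \<Rightarrow> real"
    and b :: "'a \<Rightarrow> 'q::finite \<Rightarrow> real"
    and p :: "'q pmf"
    and m :: nat
    and \<gamma> :: real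
    and alg :: "('a, 'q) online_alg"
  assumes "adwords_instance B b"
    and "\<gamma> \<in> {0..1}"
    and "max_bid_ratio B b = \<gamma>"
    and "greedy B b alg"
  shows "measure_pmf.expectation (replicate_pmf m p) (revenue B b alg)
           \<ge> (1 - 1 / exp 1) * lp_opt B b (\<lambda>j. real m * pmf p j)"
proof (cases "m = 0")
  case True
  \<comment> \<open>Without queries the objective vanishes identically; the gain bound divides by
    \<open>m\<close>, hence the separate case.\<close>
  then have "lp_opt B b (\<lambda>j. real m * pmf p j) = 0"
    using lp_feasible_nonempty[OF assms(1)] by (simp add: lp_opt_def)
  with True show ?thesis by (simp add: revenue_def)
next
  case False
  let ?E = "measure_pmf.expectation (replicate_pmf m p) (revenue B b alg)"
  have pos: "0 < 1 - 1 / exp (1::real)" by simp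
  \<comment> \<open>With the positive constant on the right, the supremum can be bounded one
    feasible point at a time.\<close>
  have "lp_opt B b (\<lambda>j. real m * pmf p j) \<le> ?E / (1 - 1 / exp 1)"
    unfolding lp_opt_def
  proof (rule cSUP_least[OF lp_feasible_nonempty[OF assms(1)]])
    fix x assume x: "x \<in> lp_feasible B b (\<lambda>j. real m * pmf p j)"
    define C where "C = (\<Sum>i\<in>UNIV. \<Sum>j\<in>UNIV. b i j * x i j * (real m * pmf p j))"
    have "0 \<le> C"
      using assms(1) x unfolding C_def
      by (intro sum_nonneg mult_nonneg_nonneg) (auto simp: adwords_instance_def lp_feasible_def)
    then have "(1 - 1 / exp 1) * C \<le> C - (1 - 1 / m) ^ m * C"
      using mult_right_mono[OF one_minus_inverse_power_le[of m], of C] False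
      by (simp add: left_diff_distrib)
    also have "\<dots> \<le> ?E"
      \<comment> \<open>With the empty history the revenue so far is 0, so the initial gap is all of
        \<open>C\<close>.\<close>
      using expected_greedy_revenue[OF assms(1,4) _ x C_def, of m "[]"] False
      by (simp add: revenue_eq_spent_budget[of B b alg "[]"])
    finally show "(\<Sum>i\<in>UNIV. \<Sum>j\<in>UNIV. b i j * x i j * (real m * pmf p j)) \<le> ?E / (1 - 1 / exp 1)"
      using pos by (simp add: C_def pos_le_divide_eq mult.commute)
  qed
  then show ?thesis using pos by (simp add: pos_le_divide_eq mult.commute)
qed

end
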